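(* Let $m\in\mathbb{N}$. For each $j\in\{1,\dots,m\}$ let $(q^{(j)}_k)_{k\ge1}$ be a sequence of positive integers with $q^{(j)}_{k+1}\ge q^{(j)}_k(q^{(j)}_k+1)$ for all $k\ge1$, let $(\xi^{(j)}_k)_{k\ge1}$ be a sequence of random variables taking the values $0$ and $1$ with probabilities $p^{(j)}_{0k}$ and $p^{(j)}_{1k}$ respectively, and let $$\xi^{(j)}=\sum_{k=1}^\infty\frac{(-1)^{k+1}\xi^{(j)}_k}{q^{(j)}_k}.$$ Then the random variable $$\widetilde\psi=\sum_{j=1}^m\xi^{(j)}$$ has an anomalously fractal singular distribution.
   Context: All random variables are defined on a common probability space, and $p^{(j)}_{0k},p^{(j)}_{1k}\ge0$, $p^{(j)}_{0k}+p^{(j)}_{1k}=1$. The spectrum (topological support) of the distribution of a real random variable is its minimal closed support. A distribution is called anomalously fractal singular if it is singular with respect to Lebesgue measure and its spectrum has Hausdorff dimension $0$. *)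

theory Defs
  imports "HOL-Probability.Probability"
begin

text \<open>
  For a Borel measure on a second countable space (such as the real line) the intersection of
  all closed sets of full measure has itself full measure, so it is the minimal closed support;
  see \<open>topological_support_minimal\<close> below.
\<close>

definition topological_support :: "'a::topological_space measure \<Rightarrow> 'a set" where
  "topological_support \<mu> = \<Inter>{C. closed C \<and> emeasure \<mu> (- C) = 0}"

lemma topological_support_minimal:
  fixes \<mu> :: "'a::second_countable_topology measure"
  assumes "sets \<mu> = sets borel"
  shows "closed (topological_support \<mu>)"
    and "emeasure \<mu> (- topological_support \<mu>) = 0"
    and "\<And>C. closed C \<Longrightarrow> emeasure \<mu> (- C) = 0 \<Longrightarrow> topological_support \<mu> \<subseteq> C"
proof -
  show "closed (topological_support \<mu>)"
    unfolding topological_support_def by auto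
  show "\<And>C. closed C \<Longrightarrow> emeasure \<mu> (- C) = 0 \<Longrightarrow> topological_support \<mu> \<subseteq> C"
    unfolding topological_support_def by auto
  define F where "F = {U. open U \<and> emeasure \<mu> U = 0}"
  obtain F' where F': "F' \<subseteq> F" "countable F'" "\<Union>F' = \<Union>F"
    using Lindelof[of F] unfolding F_def by blast
  have "- topological_support \<mu> = \<Union>F"
  proof (intro equalityI subsetI)
    fix x assume "x \<in> - topological_support \<mu>"
    then obtain C where "closed C" "emeasure \<mu> (- C) = 0" "x \<notin> C"
      unfolding topological_support_def by auto
    then show "x \<in> \<Union>F"
      unfolding F_def by (intro UnionI[of "- C"]) auto
  next
    fix x assume "x \<in> \<Union>F"
    then obtain U where "open U" "emeasure \<mu> U = 0" "x \<in> U"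
      unfolding F_def by auto
    then have "closed (- U)" "emeasure \<mu> (- (- U)) = 0" "x \<notin> - U" by auto
    then show "x \<in> - topological_support \<mu>"
      unfolding topological_support_def by blast
  qed
  moreover have "(\<Union>U\<in>F'. U) \<in> null_sets \<mu>"
    using F'(1,2) by (intro null_sets_UN') (auto simp: F_def assms null_sets_def)
  ultimately show "emeasure \<mu> (- topological_support \<mu>) = 0"
    using F'(3) by (auto simp: null_sets_def)
qed

definition mutually_singular :: "'a measure \<Rightarrow> 'a measure \<Rightarrow> bool" where
  "mutually_singular \<mu> \<nu> \<longleftrightarrow>
     (\<exists>A \<in> sets \<mu> \<inter> sets \<nu>. emeasure \<mu> (space \<mu> - A) = 0 \<and> emeasure \<nu> A = 0)"

text \<open>
  The gauge \<open>(diam U)\<^sup>s\<close> follows the usual convention that for \<open>s = 0\<close> every nonempty set counts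
  \<open>1\<close>; this has to be said explicitly because \<open>0 powr 0 = 0\<close>.
\<close>

definition diam_pow :: "real \<Rightarrow> 'a::metric_space set \<Rightarrow> ennreal" where
  "diam_pow s U =
     (if U = {} then 0 else if s = 0 then 1 else ennreal (diameter U powr s))"

text \<open>
  Boundedness of the covering sets is required because \<^const>\<open>diameter\<close> has no meaningful value
  on unbounded sets. Finite covers are included, as covering sets may be empty.
\<close>

definition hausdorff_premeasure :: "real \<Rightarrow> real \<Rightarrow> 'a::metric_space set \<Rightarrow> ennreal" where
  "hausdorff_premeasure s \<delta> A =
     Inf {(\<Sum>i. diam_pow s (U i)) | U :: nat \<Rightarrow> 'a set.
            A \<subseteq> (\<Union>i. U i) \<and> (\<forall>i. bounded (U i) \<and> diameter (U i) \<le> \<delta>)}"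

definition hausdorff_measure :: "real \<Rightarrow> 'a::metric_space set \<Rightarrow> ennreal" where
  "hausdorff_measure s A = (SUP \<delta>\<in>{0<..}. hausdorff_premeasure s \<delta> A)"

definition hausdorff_dim :: "'a::metric_space set \<Rightarrow> ennreal" where
  "hausdorff_dim A = Inf {ennreal s | s. s \<ge> 0 \<and> hausdorff_measure s A = 0}"

definition anomalously_fractal_singular :: "real measure \<Rightarrow> bool" where
  "anomalously_fractal_singular \<mu> \<longleftrightarrow>
     mutually_singular \<mu> lborel \<and> hausdorff_dim (topological_support \<mu>) = 0"

text \<open>The series is indexed from \<open>k = 1\<close>; the value of \<open>q\<close> at \<open>0\<close> is irrelevant.\<close>

definition ostrogradsky_sum :: "(nat \<Rightarrow> nat) \<Rightarrow> (nat \<Rightarrow> 'a \<Rightarrow> real) \<Rightarrow> 'a \<Rightarrow> real" where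
  "ostrogradsky_sum q \<xi> \<omega> =
     (\<Sum>i. let k = Suc i in (-1) ^ (k + 1) * \<xi> k \<omega> / real (q k))"

end

theory Submission
  imports Defs "HOL-Real_Asymp.Real_Asymp"
begin

text \<open>
  The growth condition makes every \<open>q\<^sub>k\<close> doubly exponential, because
  \<open>q\<^bsub>k+1\<^esub> \<ge> q\<^sub>k\<^sup>2\<close> and \<open>q\<^sub>2 \<ge> 2\<close>. Truncating each of the \<open>m\<close> series after \<open>n + 1\<close> digits
  therefore leaves an error of at most \<open>2 / 2 ^ (2 ^ n)\<close> per series, while there are only
  \<open>2 ^ (m * (n + 1))\<close> possible truncations. Almost every value of the sum thus lies, for every
  \<open>n\<close>, in a union of that many closed intervals of radius \<open>2 * m / 2 ^ (2 ^ n)\<close>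
  (\<open>ostrogradsky_sum_in_truncation_ball\<close>). The intersection \<open>C\<close> of these finite unions over all
  \<open>n\<close> is a closed set of full measure, so it contains the topological support.

  A single exponential in the number of intervals is beaten by any power of the doubly exponential
  radius (\<open>exponential_times_double_exponential_powr_tendsto_0\<close>). Hence \<open>C\<close> has vanishing
  \<open>s\<close>-dimensional Hausdorff measure for every \<open>s > 0\<close>, and taking exponent \<open>1\<close> it is also
  Lebesgue null. The first fact gives dimension \<open>0\<close> of the support, the second gives singularity.
\<close>

section \<open>Sets with very economical finite covers\<close>

lemma hausdorff_premeasure_finite_cball_cover:
  fixes A F :: "real set"
  assumes "finite F" and "A \<subseteq> (\<Union>c\<in>F. cball c r)" and "0 \<le> r" and "2 * r \<le> \<delta>" and "s > 0"
  shows "hausdorff_premeasure s \<delta> A \<le> ennreal (real (card F) * (2 * r) powr s)"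
proof -
  obtain g and N :: nat where g: "bij_betw g {..<N} F" and N: "N = card F"
    using ex_bij_betw_nat_finite[OF assms(1)] by (auto simp: atLeast0LessThan)
  define U where "U i = (if i < N then cball (g i) r else {})" for i
  have "F = g ` {..<N}" using g by (simp add: bij_betw_def)
  then have "A \<subseteq> (\<Union>i\<in>{..<N}. cball (g i) r)" using assms(2) by simp
  also have "\<dots> \<subseteq> (\<Union>i. U i)" unfolding U_def by fastforce
  finally have cover: "A \<subseteq> (\<Union>i. U i)" .
  have small: "\<forall>i. bounded (U i) \<and> diameter (U i) \<le> \<delta>"
    using assms(3,4) by (simp add: U_def diameter_cball)
  have "hausdorff_premeasure s \<delta> A \<le> (\<Sum>i. diam_pow s (U i))"
    unfolding hausdorff_premeasure_def using cover small by (intro Inf_lower) blast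
  also have "\<dots> = (\<Sum>i<N. diam_pow s (U i))"
    by (rule suminf_finite) (auto simp: U_def diam_pow_def)
  also have "\<dots> = (\<Sum>i<N. ennreal ((2 * r) powr s))"
    using assms(3,5) by (intro sum.cong) (auto simp: U_def diam_pow_def diameter_cball)
  also have "\<dots> = ennreal (real (card F) * (2 * r) powr s)"
    by (simp add: N ennreal_mult ennreal_of_nat_eq_real_of_nat)
  finally show ?thesis .
qed

text \<open>
  Once \<open>2 * r n\<close> has dropped below \<open>\<delta>\<close>, the \<open>n\<close>-th cover is admissible for the \<open>\<delta>\<close>-premeasure,
  so every premeasure lies below a sequence that tends to \<open>0\<close>. As this happens for each \<open>s > 0\<close>,
  the infimum that defines the dimension is \<open>0\<close>.
\<close>

lemma hausdorff_dim_eq_0_if_economical_cball_covers: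
  fixes A :: "real set" and F :: "nat \<Rightarrow> real set" and N r :: "nat \<Rightarrow> real"
  assumes "\<And>n. finite (F n)" and "\<And>n. real (card (F n)) \<le> N n"
    and "\<And>n. A \<subseteq> (\<Union>c\<in>F n. cball c (r n))" and "\<And>n. 0 \<le> r n" and "r \<longlonglongrightarrow> 0"
    and "\<And>s. s > 0 \<Longrightarrow> (\<lambda>n. N n * (2 * r n) powr s) \<longlonglongrightarrow> 0"
  shows "hausdorff_dim A = 0"
proof -
  have meas: "hausdorff_measure s A = 0" if s: "s > 0" for s
  proof -
    have "hausdorff_premeasure s \<delta> A \<le> 0" if "\<delta> > 0" for \<delta>
    proof (rule tendsto_lowerbound)
      show "(\<lambda>n. ennreal (N n * (2 * r n) powr s)) \<longlonglongrightarrow> 0"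
        using tendsto_ennrealI[OF assms(6)[OF s]] by simp
      have "(\<lambda>n. 2 * r n) \<longlonglongrightarrow> 0" using tendsto_mult_left[OF assms(5), of 2] by simp
      then have "\<forall>\<^sub>F n in sequentially. 2 * r n < \<delta>" using that by (rule order_tendstoD)
      then show "\<forall>\<^sub>F n in sequentially.
          hausdorff_premeasure s \<delta> A \<le> ennreal (N n * (2 * r n) powr s)"
      proof eventually_elim
        case (elim n)
        have "hausdorff_premeasure s \<delta> A \<le> ennreal (real (card (F n)) * (2 * r n) powr s)"
          using elim assms s by (intro hausdorff_premeasure_finite_cball_cover) auto
        also have "\<dots> \<le> ennreal (N n * (2 * r n) powr s)"
          using assms(2) by (intro ennreal_leI mult_right_mono) auto
        finally show ?case .
      qed
    qed simp
    then show ?thesis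
      unfolding hausdorff_measure_def by (auto simp: SUP_eq_const intro!: antisym SUP_least)
  qed
  have "hausdorff_dim A \<le> ennreal e" if "e > 0" for e
    unfolding hausdorff_dim_def using meas[OF that] that by (intro Inf_lower CollectI exI[of _ e]) simp
  then have "hausdorff_dim A \<le> 0 + ennreal e" if "e > 0" for e using that by simp
  then have "hausdorff_dim A \<le> 0" by (rule ennreal_le_epsilon)
  then show ?thesis by simp
qed

lemma emeasure_lborel_eq_0_if_economical_cball_covers:
  fixes A :: "real set" and F :: "nat \<Rightarrow> real set" and N r :: "nat \<Rightarrow> real"
  assumes "\<And>n. finite (F n)" and "\<And>n. real (card (F n)) \<le> N n"
    and "\<And>n. A \<subseteq> (\<Union>c\<in>F n. cball c (r n))" and "\<And>n. 0 \<le> r n"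
    and "(\<lambda>n. N n * (2 * r n)) \<longlonglongrightarrow> 0"
  shows "emeasure lborel A = 0"
proof -
  have "emeasure lborel A \<le> ennreal (N n * (2 * r n))" for n
  proof -
    have "emeasure lborel A \<le> emeasure lborel (\<Union>c\<in>F n. cball c (r n))"
      using assms(1,3) by (intro emeasure_mono) (auto intro!: sets.finite_UN)
    also have "\<dots> \<le> (\<Sum>c\<in>F n. emeasure lborel (cball c (r n)))"
      using assms(1) by (intro emeasure_subadditive_finite) auto
    also have "\<dots> = (\<Sum>c\<in>F n. ennreal (2 * r n))"
      using assms(4) by (intro sum.cong) (auto simp: cball_eq_atLeastAtMost algebra_simps)
    also have "\<dots> = ennreal (real (card (F n)) * (2 * r n))"
      using assms(4) by (simp add: ennreal_mult ennreal_of_nat_eq_real_of_nat)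
    also have "\<dots> \<le> ennreal (N n * (2 * r n))"
      using assms(2,4) by (intro ennreal_leI mult_right_mono) auto
    finally show ?thesis .
  qed
  then have "emeasure lborel A \<le> 0"
    using tendsto_ennrealI[OF assms(5)]
    by (intro tendsto_lowerbound[where f = "\<lambda>n. ennreal (N n * (2 * r n))"]) auto
  then show ?thesis by simp
qed

section \<open>Truncation of Ostrogradsky series\<close>

lemma ostrogradsky_double_exponential_growth:
  fixes a :: "nat \<Rightarrow> nat"
  assumes pos: "\<And>i. a i > 0" and step: "\<And>i. a (Suc i) \<ge> a i * (a i + 1)"
  shows "a (Suc n) \<ge> 2 ^ (2 ^ n)"
proof (induction n)
  case 0
  have "1 * 2 \<le> a 0 * (a 0 + 1)" using pos[of 0] by (intro mult_mono) auto
  then show ?case using step[of 0] by simp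
next
  case (Suc n)
  have "(2::nat) ^ (2 ^ Suc n) = 2 ^ (2 ^ n) * 2 ^ (2 ^ n)" by (simp add: power_add mult_2)
  also have "\<dots> \<le> a (Suc n) * (a (Suc n) + 1)" using Suc by (intro mult_mono) auto
  also have "\<dots> \<le> a (Suc (Suc n))" by (rule step)
  finally show ?case .
qed

text \<open>
  Past index \<open>n\<close> the denominators at least double at every step, so the remainder of the series is
  dominated by a geometric series with ratio \<open>1/2\<close> that starts at \<open>1 / 2 ^ (2 ^ n)\<close>.
\<close>

lemma ostrogradsky_truncation_error:
  fixes a :: "nat \<Rightarrow> nat" and d :: "nat \<Rightarrow> real"
  assumes pos: "\<And>i. a i > 0" and step: "\<And>i. a (Suc i) \<ge> a i * (a i + 1)"
    and d: "\<And>i. \<bar>d i\<bar> \<le> 1"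
  shows "\<bar>(\<Sum>i. d i / real (a i)) - (\<Sum>i\<le>n. d i / real (a i))\<bar> \<le> 2 / 2 ^ (2 ^ n)"
proof -
  let ?f = "\<lambda>i. d i / real (a i)"
  have grow: "a (i + Suc n) \<ge> 2 ^ i * 2 ^ (2 ^ n)" for i
  proof (induction i)
    case 0
    then show ?case using ostrogradsky_double_exponential_growth[of a n, OF pos step] by simp
  next
    case (Suc i)
    have "2 * a (i + Suc n) \<le> (a (i + Suc n) + 1) * a (i + Suc n)"
      using pos[of "i + Suc n"] by (intro mult_right_mono) auto
    also have "\<dots> \<le> a (Suc i + Suc n)" using step[of "i + Suc n"] by (simp add: mult.commute)
    finally show ?case using Suc by simp
  qed
  define g where "g i = (1 / 2) ^ i * (1 / 2 ^ (2 ^ n) :: real)" for i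
  have g_sums: "g sums (2 * (1 / 2 ^ (2 ^ n)))"
    unfolding g_def using geometric_sums[of "1 / 2 :: real"] by (intro sums_mult2) simp
  have le: "norm (?f (i + Suc n)) \<le> g i" for i
  proof -
    have "norm (?f (i + Suc n)) \<le> 1 / real (a (i + Suc n))"
      using d[of "i + Suc n"] by (simp add: divide_right_mono)
    also have "\<dots> \<le> 1 / real (2 ^ i * 2 ^ (2 ^ n))"
      using grow[of i] by (intro divide_left_mono) (auto simp: pos simp del: of_nat_mult of_nat_power)
    also have "\<dots> = g i" by (simp add: g_def power_one_over)
    finally show ?thesis .
  qed
  have tail: "summable (\<lambda>i. norm (?f (i + Suc n)))"
    using le g_sums by (intro summable_comparison_test'[OF sums_summable[OF g_sums], of 0]) auto
  then have "summable (\<lambda>i. ?f (i + Suc n))" by (rule summable_norm_cancel)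
  then have "summable ?f" by (subst (asm) summable_iff_shift)
  then have "(\<Sum>i. ?f i) - (\<Sum>i\<le>n. ?f i) = (\<Sum>i. ?f (i + Suc n))"
    using suminf_split_initial_segment[of ?f "Suc n"] by (simp add: lessThan_Suc_atMost)
  also have "\<bar>\<dots>\<bar> \<le> (\<Sum>i. norm (?f (i + Suc n)))"
    using summable_norm[OF tail] by simp
  also have "\<dots> \<le> (\<Sum>i. g i)"
    using le tail sums_summable[OF g_sums] by (intro suminf_le) auto
  also have "\<dots> = 2 / 2 ^ (2 ^ n)" using sums_unique[OF g_sums] by simp
  finally show ?thesis .
qed

text \<open>
  A set \<open>D\<close> of pairs \<open>(j, i)\<close> records which digits equal \<open>1\<close>, so counting truncations reduces to
  counting subsets of \<open>{1..m} \<times> {..n}\<close>. Digit positions start at \<open>0\<close> here; position \<open>i\<close>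
  belongs to the denominator \<open>q j (Suc i)\<close>.
\<close>

definition truncated_sum :: "nat \<Rightarrow> (nat \<Rightarrow> nat \<Rightarrow> nat) \<Rightarrow> nat \<Rightarrow> (nat \<times> nat) set \<Rightarrow> real" where
  "truncated_sum m q n D =
     (\<Sum>j=1..m. \<Sum>i\<le>n. (-1) ^ i * of_bool ((j, i) \<in> D) / real (q j (Suc i)))"

definition truncations :: "nat \<Rightarrow> (nat \<Rightarrow> nat \<Rightarrow> nat) \<Rightarrow> nat \<Rightarrow> real set" where
  "truncations m q n = truncated_sum m q n ` Pow ({1..m} \<times> {..n})"

lemma finite_truncations: "finite (truncations m q n)"
  by (simp add: truncations_def)

lemma card_truncations_le: "card (truncations m q n) \<le> 2 ^ (m * (n + 1))"
proof -
  have "card (truncations m q n) \<le> card (Pow ({1..m} \<times> {..n}))"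
    unfolding truncations_def by (intro card_image_le) auto
  then show ?thesis by (simp add: card_Pow card_cartesian_product)
qed

text \<open>
  The right truncation is the one whose digit pattern is that of \<open>\<omega>\<close> itself. Each of the \<open>m\<close> series
  contributes its own truncation error, which gives the factor \<open>m\<close> in the radius.
\<close>

lemma ostrogradsky_sum_in_truncation_ball:
  fixes q :: "nat \<Rightarrow> nat \<Rightarrow> nat" and \<xi> :: "nat \<Rightarrow> nat \<Rightarrow> 'a \<Rightarrow> real"
  assumes pos: "\<And>j k. j \<in> {1..m} \<Longrightarrow> k \<ge> 1 \<Longrightarrow> q j k > 0"
    and step: "\<And>j k. j \<in> {1..m} \<Longrightarrow> k \<ge> 1 \<Longrightarrow> q j (k + 1) \<ge> q j k * (q j k + 1)"
    and digits: "\<And>j k. j \<in> {1..m} \<Longrightarrow> k \<ge> 1 \<Longrightarrow> \<xi> j k \<omega> \<in> {0, 1}"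
  shows "(\<Sum>j=1..m. ostrogradsky_sum (q j) (\<xi> j) \<omega>)
           \<in> (\<Union>c\<in>truncations m q n. cball c (2 * real m / 2 ^ (2 ^ n)))"
proof -
  define D where "D = {(j, i) \<in> {1..m} \<times> {..n}. \<xi> j (Suc i) \<omega> = 1}"
  define f where "f j i = ((-1) ^ i * \<xi> j (Suc i) \<omega>) / real (q j (Suc i))" for j i
  have trunc: "truncated_sum m q n D = (\<Sum>j=1..m. \<Sum>i\<le>n. f j i)"
    unfolding truncated_sum_def f_def
  proof (intro sum.cong refl)
    fix j i assume "j \<in> {1..m}" "i \<in> {..n}"
    then show "(-1) ^ i * of_bool ((j, i) \<in> D) / real (q j (Suc i)) =
        (-1) ^ i * \<xi> j (Suc i) \<omega> / real (q j (Suc i))"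
      using digits[of j "Suc i"] by (auto simp: D_def)
  qed
  have err: "\<bar>ostrogradsky_sum (q j) (\<xi> j) \<omega> - (\<Sum>i\<le>n. f j i)\<bar> \<le> 2 / 2 ^ (2 ^ n)"
    if j: "j \<in> {1..m}" for j
  proof -
    have "ostrogradsky_sum (q j) (\<xi> j) \<omega> = (\<Sum>i. f j i)"
      by (simp add: ostrogradsky_sum_def f_def)
    moreover have "\<bar>(-1) ^ i * \<xi> j (Suc i) \<omega>\<bar> \<le> 1" for i
      using digits[OF j, of "Suc i"] by (auto simp: abs_mult)
    ultimately show ?thesis
      unfolding f_def using pos[OF j] step[OF j]
      by (simp only:, intro ostrogradsky_truncation_error) auto
  qed
  have "\<bar>(\<Sum>j=1..m. ostrogradsky_sum (q j) (\<xi> j) \<omega>) - truncated_sum m q n D\<bar>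
      = \<bar>\<Sum>j=1..m. ostrogradsky_sum (q j) (\<xi> j) \<omega> - (\<Sum>i\<le>n. f j i)\<bar>"
    by (simp add: trunc sum_subtractf)
  also have "\<dots> \<le> (\<Sum>j=1..m. 2 / 2 ^ (2 ^ n))"
    using err by (intro order_trans[OF sum_abs] sum_mono) auto
  finally have "dist (truncated_sum m q n D) (\<Sum>j=1..m. ostrogradsky_sum (q j) (\<xi> j) \<omega>)
      \<le> 2 * real m / 2 ^ (2 ^ n)"
    by (simp add: dist_real_def abs_minus_commute mult.commute)
  moreover have "truncated_sum m q n D \<in> truncations m q n"
    by (auto simp: truncations_def D_def)
  ultimately show ?thesis by auto
qed

text \<open>
  On a logarithmic scale the factors are linear in \<open>n\<close> and of order \<open>- s * 2 ^ n\<close>, so the second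
  one wins for every positive \<open>s\<close>.
\<close>

lemma exponential_times_double_exponential_powr_tendsto_0:
  assumes "b > 0" and "s > 0"
  shows "(\<lambda>n. 2 ^ (m * (n + 1)) * (b / 2 ^ (2 ^ n)) powr s) \<longlonglongrightarrow> (0 :: real)"
proof -
  have eq: "2 ^ (m * (n + 1)) * (b / 2 ^ (2 ^ n)) powr s =
      b powr s * 2 powr (real m * (real n + 1) - s * 2 powr real n)" for n
  proof -
    have "(b / 2 ^ (2 ^ n)) powr s = b powr s * 2 powr (- s * 2 powr real n)"
      using assms(1)
      by (simp add: powr_divide powr_powr powr_minus_divide mult.commute
            flip: powr_realpow)
    moreover have "(2 :: real) ^ (m * (n + 1)) = 2 powr (real m * (real n + 1))"
      by (simp add: algebra_simps flip: powr_realpow)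
    ultimately show ?thesis by (simp add: powr_diff powr_minus_divide)
  qed
  have "(\<lambda>n. b powr s * 2 powr (real m * (real n + 1) - s * 2 powr real n)) \<longlonglongrightarrow> 0"
    using assms by real_asymp
  then show ?thesis unfolding eq .
qed

section \<open>The distribution of the sum\<close>

lemma (in prob_space) AE_digit_in_01:
  assumes "X \<in> borel_measurable M"
    and "prob {\<omega> \<in> space M. X \<omega> = (0 :: real)} + prob {\<omega> \<in> space M. X \<omega> = 1} = 1"
  shows "AE \<omega> in M. X \<omega> \<in> {0, 1}"
proof -
  have [measurable]: "X \<in> borel_measurable M" by (rule assms(1))
  have "{\<omega> \<in> space M. X \<omega> \<in> {0, 1}} = {\<omega> \<in> space M. X \<omega> = 0} \<union> {\<omega> \<in> space M. X \<omega> = 1}"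
    by auto
  moreover have "prob \<dots> = 1"
    using assms(2) by (subst finite_measure_Union) auto
  ultimately have "prob {\<omega> \<in> space M. X \<omega> \<in> {0, 1}} = 1" by simp
  then show ?thesis by (subst (asm) prob_Collect_eq_1) auto
qed

theorem theorem4:
  fixes M :: "'a measure"
    and m :: nat
    and q :: "nat \<Rightarrow> nat \<Rightarrow> nat"
    and p0 p1 :: "nat \<Rightarrow> nat \<Rightarrow> real"
    and \<xi> :: "nat \<Rightarrow> nat \<Rightarrow> 'a \<Rightarrow> real"
  assumes "prob_space M"
    and "m \<ge> 1"
    and "\<And>j k. j \<in> {1..m} \<Longrightarrow> k \<ge> 1 \<Longrightarrow> q j k > 0"
    and "\<And>j k. j \<in> {1..m} \<Longrightarrow> k \<ge> 1 \<Longrightarrow> q j (k + 1) \<ge> q j k * (q j k + 1)"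
    and "\<And>j k. j \<in> {1..m} \<Longrightarrow> k \<ge> 1 \<Longrightarrow> p0 j k \<ge> 0 \<and> p1 j k \<ge> 0 \<and> p0 j k + p1 j k = 1"
    and "\<And>j k. j \<in> {1..m} \<Longrightarrow> k \<ge> 1 \<Longrightarrow> \<xi> j k \<in> borel_measurable M"
    and "\<And>j k. j \<in> {1..m} \<Longrightarrow> k \<ge> 1 \<Longrightarrow>
           measure M {\<omega> \<in> space M. \<xi> j k \<omega> = 0} = p0 j k"
    and "\<And>j k. j \<in> {1..m} \<Longrightarrow> k \<ge> 1 \<Longrightarrow>
           measure M {\<omega> \<in> space M. \<xi> j k \<omega> = 1} = p1 j k"
  shows "anomalously_fractal_singular
           (distr M borel (\<lambda>\<omega>. \<Sum>j = 1..m. ostrogradsky_sum (q j) (\<xi> j) \<omega>))"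
proof -
  interpret prob_space M by (rule assms(1))
  let ?\<psi> = "\<lambda>\<omega>. \<Sum>j = 1..m. ostrogradsky_sum (q j) (\<xi> j) \<omega>"
  let ?\<mu> = "distr M borel ?\<psi>"
  define r where "r n = 2 * real m / 2 ^ (2 ^ n)" for n
  define C where "C = (\<Inter>n. \<Union>c\<in>truncations m q n. cball c (r n))"
  have \<psi>_measurable: "?\<psi> \<in> borel_measurable M"
    unfolding ostrogradsky_sum_def Let_def using assms(6)
    by (intro borel_measurable_sum borel_measurable_suminf borel_measurable_divide
          borel_measurable_times borel_measurable_const) auto
  have closed_C: "closed C"
    unfolding C_def by (intro closed_INT ballI closed_UN finite_truncations) auto
  then have C_borel: "C \<in> sets borel" by (rule borel_closed)
  have r_nonneg: "0 \<le> r n" for n by (simp add: r_def)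
  have card: "real (card (truncations m q n)) \<le> 2 ^ (m * (n + 1))" for n
    using card_truncations_le[of m q n] by (metis of_nat_le_iff of_nat_numeral of_nat_power)
  have cover: "C \<subseteq> (\<Union>c\<in>truncations m q n. cball c (r n))" for n by (auto simp: C_def)
  \<comment> \<open>The constant \<open>4 * m\<close> arises because the diameters are twice the radii.\<close>
  have economical: "(\<lambda>n. 2 ^ (m * (n + 1)) * (2 * r n) powr s) \<longlonglongrightarrow> 0" if "s > 0" for s
    using exponential_times_double_exponential_powr_tendsto_0[of "4 * real m" s m] that assms(2)
    by (simp add: r_def)
  have r_tendsto: "r \<longlonglongrightarrow> 0" unfolding r_def by real_asymp
  have "AE \<omega> in M. \<xi> j k \<omega> \<in> {0, 1}" if "j \<in> {1..m}" "k \<ge> 1" for j k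
    using assms(5-8)[OF that] by (intro AE_digit_in_01) auto
  then have "AE \<omega> in M. \<forall>j\<in>{1..m}. \<forall>k\<in>{1..}. \<xi> j k \<omega> \<in> {0, 1}"
    by (intro AE_ball_countable' ballI) auto
  then have "AE \<omega> in M. ?\<psi> \<omega> \<in> C"
  proof eventually_elim
    case (elim \<omega>)
    then show ?case
      unfolding C_def r_def using assms(3,4)
      by (intro INT_I ostrogradsky_sum_in_truncation_ball) auto
  qed
  then have "AE x in ?\<mu>. x \<in> C"
    using \<psi>_measurable C_borel by (subst AE_distr_iff) auto
  then have C_full: "emeasure ?\<mu> (- C) = 0"
    using C_borel by (subst (asm) AE_iff_measurable[where N = "- C"]) auto
  have "emeasure lborel C = 0"
  proof (rule emeasure_lborel_eq_0_if_economical_cball_covers[OF finite_truncations card cover r_nonneg])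
    show "(\<lambda>n. 2 ^ (m * (n + 1)) * (2 * r n)) \<longlonglongrightarrow> 0"
      using economical[of 1] r_nonneg by simp
  qed
  then have "mutually_singular ?\<mu> lborel"
    unfolding mutually_singular_def using C_full C_borel
    by (intro bexI[of _ C]) (auto simp: Compl_eq_Diff_UNIV)
  moreover have "topological_support ?\<mu> \<subseteq> C"
    using closed_C C_full by (intro topological_support_minimal(3)) auto
  then have "hausdorff_dim (topological_support ?\<mu>) = 0"
    using cover finite_truncations card r_nonneg r_tendsto economical
    by (intro hausdorff_dim_eq_0_if_economical_cball_covers
          [where F = "truncations m q" and r = r and N = "\<lambda>n. 2 ^ (m * (n + 1))"]) blast+
  ultimately show ?thesis by (simp add: anomalously_fractal_singular_def)
qed

end
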